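(* Let $s\geq 3$ and $r\geq s+2$ be integers and let $n$ be a positive integer. Let $G$ be a balanced $r$-partite graph on $rn$ vertices with $\hat\delta(G)\geq(1-c)n$, where $c$ is a real number with $$c\leq\frac{1}{(s-2)(s+1)(s-1)^4}.$$ Then $G$ admits a fractional $K_s$-decomposition.
   Context: All graphs are finite, undirected and simple. An $r$-partite graph $G$ with parts $V_1,\dots,V_r$ (a partition of $V(G)$ with no edge inside any part) is balanced if $|V_1|=\cdots=|V_r|$. $d(v,U)$ is the number of neighbours of $v$ in $U$. The partite minimum degree is $\hat\delta(G)=\min\{d(v,V_i):1\leq i\leq r,\ v\in V(G)\setminus V_i\}$. A copy of $K_s$ in $G$ is a subgraph of $G$ isomorphic to the complete graph on $s$ vertices. A fractional $K_s$-decomposition of $G$ is a weight function $w$ from the set of copies of $K_s$ in $G$ to $[0,1]$ such that for each edge $e\in E(G)$ the total weight of the copies of $K_s$ containing $e$ equals $1$. *)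

theory Defs
  imports Complex_Main "HOL-Library.Disjoint_Sets" "Graph_Theory.Kuratowski"
begin

text \<open>
  Finite simple graphs are the \<^locale>\<open>pair_graph\<close>s of the entry Graph_Theory: finite, loop-free,
  symmetric digraphs without parallel arcs. An edge uv is thus represented by the two arcs
  \<open>(u, v)\<close> and \<open>(v, u)\<close>.
\<close>

definition r_partite :: "'a pair_pre_digraph \<Rightarrow> nat \<Rightarrow> (nat \<Rightarrow> 'a set) \<Rightarrow> bool" where
  "r_partite G r V \<longleftrightarrow>
     pair_graph G \<and>
     (\<Union>i\<in>{1..r}. V i) = pverts G \<and>
     disjoint_family_on V {1..r} \<and>
     (\<forall>i\<in>{1..r}. \<forall>u\<in>V i. \<forall>v\<in>V i. (u, v) \<notin> parcs G)"

definition balanced_parts :: "nat \<Rightarrow> (nat \<Rightarrow> 'a set) \<Rightarrow> bool" where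
  "balanced_parts r V \<longleftrightarrow> (\<forall>i\<in>{1..r}. \<forall>j\<in>{1..r}. card (V i) = card (V j))"

definition deg_into :: "'a pair_pre_digraph \<Rightarrow> 'a \<Rightarrow> 'a set \<Rightarrow> nat" where
  "deg_into G v U = card {u \<in> U. (v, u) \<in> parcs G}"

text \<open>
  \<^const>\<open>Min\<close> is unspecified on the empty set, so this is only meaningful if some vertex lies
  outside some part, for instance if there are at least two nonempty parts.
\<close>

definition partite_min_degree :: "'a pair_pre_digraph \<Rightarrow> nat \<Rightarrow> (nat \<Rightarrow> 'a set) \<Rightarrow> nat" where
  "partite_min_degree G r V =
     Min {deg_into G v (V i) | v i. i \<in> {1..r} \<and> v \<in> pverts G - V i}"

definition K_copies :: "nat \<Rightarrow> 'a pair_pre_digraph \<Rightarrow> 'a pair_pre_digraph set" where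
  "K_copies s G = {H. subgraph (with_proj H) (with_proj G) \<and> K\<^bsub>s\<^esub> (with_proj H)}"

text \<open>
  The condition is imposed on both arcs of an edge. The two instances coincide, since a copy
  of the complete graph contains either both arcs or neither.
\<close>

definition fractional_K_decomposition ::
    "nat \<Rightarrow> 'a pair_pre_digraph \<Rightarrow> ('a pair_pre_digraph \<Rightarrow> real) \<Rightarrow> bool" where
  "fractional_K_decomposition s G w \<longleftrightarrow>
     (\<forall>H\<in>K_copies s G. w H \<in> {0..1}) \<and>
     (\<forall>e\<in>parcs G. (\<Sum>H | H \<in> K_copies s G \<and> e \<in> parcs H. w H) = 1)"

end

theory Submission
  imports Defs
begin

text \<open>
  Give every copy of \<open>K\<^sub>s\<close> the same weight \<open>1 / N\<close>, where \<open>N\<close> is the number of copies through an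
  edge of the complete \<open>r\<close>-partite graph. Since \<open>G\<close> is almost complete, each edge \<open>e\<close> then carries
  slightly less than \<open>1\<close>, and the small deficit \<open>t e\<close> has to be repaired without disturbing any other
  edge.

  The repair is local. Inside a single copy \<open>Q\<close> of \<open>K\<^bsub>s+2\<^esub>\<close> containing \<open>e\<close> there is a signed weighting
  of the \<open>s\<close>-subsets whose total is \<open>1\<close> on \<open>e\<close> and \<open>0\<close> on every other pair
  (\<open>gadget\<close>, \<open>sum_gadget\<close>); its values are at least \<open>- 1 / s\<close> (\<open>gadget_ge\<close>). Here \<open>s + 2\<close> vertices
  are what makes the pairs linearly independent as functions of the \<open>s\<close>-subsets, and \<open>r \<ge> s + 2\<close> is
  what makes such \<open>Q\<close> exist. Spreading the deficit \<open>t e\<close> evenly over all \<open>Q\<close> that contain \<open>e\<close> makes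
  the total on each edge exactly \<open>1\<close> (\<open>sum_corrected_weight\<close>).

  It remains to see that no weight becomes negative. A greedy count of clique extensions
  (\<open>card_cliques_bounds\<close>) yields \<open>t e \<le> \<epsilon>\<close> with \<open>\<epsilon> = c (s - 2) (s + 1) / 2\<close>, and shows that every
  edge lies in at least half as many copies of \<open>K\<^bsub>s+2\<^esub>\<close> as in the complete \<open>r\<close>-partite graph. As a
  given copy of \<open>K\<^sub>s\<close> lies in few copies of \<open>K\<^bsub>s+2\<^esub>\<close>, it loses at most
  \<open>(s - 1) (s + 1) (s + 2) \<epsilon> / (2 N)\<close>, which is at most \<open>1 / N\<close> for the permitted \<open>c\<close>
  (\<open>density_constant_bounds\<close>). Weights are at most \<open>1\<close> because they are nonnegative and the total on
  each edge is \<open>1\<close>.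
\<close>

section \<open>Cliques and their extensions\<close>

text \<open>
  Copies of complete graphs are handled through their vertex sets. The argument \<open>A\<close> is the set that
  the clique has to contain: \<open>{}\<close> for all cliques, an edge for the copies through that edge, and a
  clique for its larger extensions.
\<close>

definition cliques :: "'a pair_pre_digraph \<Rightarrow> nat \<Rightarrow> 'a set \<Rightarrow> 'a set set" where
  "cliques G k A = {K. A \<subseteq> K \<and> K \<subseteq> pverts G \<and> card K = k \<and>
     (\<forall>u\<in>K. \<forall>v\<in>K. u \<noteq> v \<longrightarrow> (u, v) \<in> parcs G)}"

definition common_nbrs :: "'a pair_pre_digraph \<Rightarrow> 'a set \<Rightarrow> 'a set" where
  "common_nbrs G K = {v \<in> pverts G - K. \<forall>u\<in>K. (u, v) \<in> parcs G}"

lemma finite_cliques: "finite (pverts G) \<Longrightarrow> finite (cliques G k A)"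
  by (rule finite_subset[of _ "Pow (pverts G)"]) (auto simp: cliques_def)

lemma finite_clique: "finite (pverts G) \<Longrightarrow> K \<in> cliques G k A \<Longrightarrow> finite K"
  by (auto simp: cliques_def intro: finite_subset)

lemma cliques_above_self:
  assumes "finite (pverts G)" and "A \<in> cliques G a B"
  shows "cliques G a A = {A}"
proof -
  have "K = A" if "K \<in> cliques G a A" for K
    using that assms finite_clique[OF assms(1) that]
    by (auto simp: cliques_def dest: card_subset_eq)
  then show ?thesis
    using assms(2) by (auto simp: cliques_def)
qed

text \<open>
  Both sides count the pairs of a \<open>(k + 1)\<close>-clique above \<open>A\<close> and one of its vertices outside \<open>A\<close>:
  deleting the vertex leaves a \<open>k\<close>-clique above \<open>A\<close> of which it is a common neighbour.
\<close>

lemma card_cliques_Suc: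
  assumes fin: "finite (pverts G)" and sym: "symmetric (with_proj G)"
  shows "(Suc k - card A) * card (cliques G (Suc k) A) =
         (\<Sum>K\<in>cliques G k A. card (common_nbrs G K))"
proof -
  let ?P = "Sigma (cliques G k A) (common_nbrs G)"
  let ?Q = "Sigma (cliques G (Suc k) A) (\<lambda>L. L - A)"
  have symD: "(v, u) \<in> parcs G" if "(u, v) \<in> parcs G" for u v
    using sym that by (auto simp: symmetric_def sym_def)
  have finK: "finite K" if "K \<subseteq> pverts G" for K
    using fin that by (rule rev_finite_subset)
  have "bij_betw (\<lambda>(K, v). (insert v K, v)) ?P ?Q"
  proof (rule bij_betw_byWitness[where f' = "\<lambda>(L, v). (L - {v}, v)"])
    show "\<forall>p\<in>?P. (case case p of (K, v) \<Rightarrow> (insert v K, v) of (L, v) \<Rightarrow> (L - {v}, v)) = p"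
      by (auto simp: common_nbrs_def)
    show "\<forall>p\<in>?Q. (case case p of (L, v) \<Rightarrow> (L - {v}, v) of (K, v) \<Rightarrow> (insert v K, v)) = p"
      by auto
    show "(\<lambda>(K, v). (insert v K, v)) ` ?P \<subseteq> ?Q"
      by (auto simp: cliques_def common_nbrs_def finK intro: symD)
    show "(\<lambda>(L, v). (L - {v}, v)) ` ?Q \<subseteq> ?P"
      by (auto simp: cliques_def common_nbrs_def finK)
  qed
  then have eq: "card ?P = card ?Q"
    by (rule bij_betw_same_card)
  have P: "card ?P = (\<Sum>K\<in>cliques G k A. card (common_nbrs G K))"
    by (intro card_SigmaI finite_cliques fin ballI)
       (auto simp: common_nbrs_def fin)
  have "card ?Q = (\<Sum>L\<in>cliques G (Suc k) A. card (L - A))"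
    by (intro card_SigmaI finite_cliques fin ballI)
       (auto simp: cliques_def intro: finK)
  also have "\<dots> = (\<Sum>L\<in>cliques G (Suc k) A. Suc k - card A)"
    by (intro sum.cong refl card_Diff_subset[THEN trans])
       (auto simp: cliques_def dest: finK intro: finite_subset)
  finally show ?thesis
    using eq P by simp
qed

section \<open>Counting cliques in dense partite graphs\<close>

locale dense_partite =
  fixes G :: "'a pair_pre_digraph" and r n :: nat and V :: "nat \<Rightarrow> 'a set" and c :: real
  assumes finite_pverts: "finite (pverts G)"
    and symmetric: "symmetric (with_proj G)"
    and parts_cover: "(\<Union>i\<in>{1..r}. V i) = pverts G"
    and parts_disjoint: "disjoint_family_on V {1..r}"
    and parts_independent: "i \<in> {1..r} \<Longrightarrow> u \<in> V i \<Longrightarrow> v \<in> V i \<Longrightarrow> (u, v) \<notin> parcs G"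
    and card_part: "i \<in> {1..r} \<Longrightarrow> card (V i) = n"
    and deg_into_part:
      "i \<in> {1..r} \<Longrightarrow> v \<in> pverts G - V i \<Longrightarrow> (1 - c) * n \<le> deg_into G v (V i)"
    and c_nonneg: "0 \<le> c"
begin

lemma finite_part: "i \<in> {1..r} \<Longrightarrow> finite (V i)"
  using finite_pverts parts_cover by (metis UN_upper finite_subset)

text \<open>A clique has at most one vertex in each part, so it meets as many parts as it has vertices.\<close>

lemma card_missed_parts:
  assumes "K \<in> cliques G m A"
  shows "m + card {i \<in> {1..r}. V i \<inter> K = {}} = r"
proof -
  have finK: "finite K" and cardK: "card K = m" and sub: "K \<subseteq> pverts G"
    using assms finite_clique[OF finite_pverts assms] by (auto simp: cliques_def)
  have "\<forall>v\<in>K. \<exists>i. i \<in> {1..r} \<and> v \<in> V i"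
    using sub unfolding parts_cover[symmetric] by blast
  then obtain p where p: "p v \<in> {1..r}" "v \<in> V (p v)" if "v \<in> K" for v
    by metis
  have inj: "inj_on p K"
  proof (rule inj_onI, rule ccontr)
    fix u v assume uv: "u \<in> K" "v \<in> K" "p u = p v" "u \<noteq> v"
    then have "(u, v) \<in> parcs G" using assms by (simp add: cliques_def)
    then show False using parts_independent p uv by metis
  qed
  have img: "p ` K = {i \<in> {1..r}. V i \<inter> K \<noteq> {}}"
    using p parts_disjoint unfolding disjoint_family_on_def by (safe; blast)
  have "card {1..r} = card ({i \<in> {1..r}. V i \<inter> K \<noteq> {}} \<union> {i \<in> {1..r}. V i \<inter> K = {}})"
    by (rule arg_cong[where f = card]) auto
  also have "\<dots> = card {i \<in> {1..r}. V i \<inter> K \<noteq> {}} + card {i \<in> {1..r}. V i \<inter> K = {}}"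
    by (rule card_Un_disjoint) auto
  finally show ?thesis
    using card_image[OF inj] img cardK by simp
qed

text \<open>Each vertex of \<open>K\<close> is non-adjacent to at most \<open>c n\<close> vertices of a part that it lies outside of.\<close>

lemma card_common_nbrs_in_part:
  assumes "finite K" and "K \<subseteq> pverts G" and "i \<in> {1..r}" and "V i \<inter> K = {}"
  shows "(1 - c * card K) * n \<le> card {v \<in> V i. \<forall>u\<in>K. (u, v) \<in> parcs G}"
  using assms(1,2,4)
proof (induction K rule: finite_induct)
  case empty
  then show ?case using card_part[OF assms(3)] by simp
next
  case (insert u K)
  let ?X = "{v \<in> V i. \<forall>u\<in>K. (u, v) \<in> parcs G}" and ?Y = "{v \<in> V i. (u, v) \<in> parcs G}"
  have fin: "finite (V i)"
    using assms(3) by (rule finite_part)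
  have eq: "{v \<in> V i. \<forall>w\<in>insert u K. (w, v) \<in> parcs G} = ?X \<inter> ?Y"
    by auto
  have "card ?X + card ?Y = card (?X \<union> ?Y) + card (?X \<inter> ?Y)"
    using fin by (intro card_Un_Int) auto
  moreover have "card (?X \<union> ?Y) \<le> n"
    using card_mono[OF fin, of "?X \<union> ?Y"] card_part[OF assms(3)] by auto
  moreover have "(1 - c * card K) * n \<le> card ?X"
    using insert by auto
  moreover have "(1 - c) * n \<le> card ?Y"
    using deg_into_part[OF assms(3), of u] insert.prems by (auto simp: deg_into_def)
  ultimately show ?case
    unfolding eq using insert.hyps by (simp add: algebra_simps)
qed

text \<open>
  A common neighbour cannot share a part with a vertex of \<open>K\<close>, so all of them lie in the \<open>r - m\<close>
  parts that \<open>K\<close> misses.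
\<close>

lemma card_common_nbrs:
  assumes "K \<in> cliques G m A"
  shows "card (common_nbrs G K) \<le> (r - m) * n"
    and "(1 - c * m) * ((r - m) * n) \<le> card (common_nbrs G K)"
proof -
  let ?I = "{i \<in> {1..r}. V i \<inter> K = {}}" and ?X = "\<lambda>i. {v \<in> V i. \<forall>u\<in>K. (u, v) \<in> parcs G}"
  have finK: "finite K" and cardK: "card K = m" and sub: "K \<subseteq> pverts G"
    using assms finite_clique[OF finite_pverts assms] by (auto simp: cliques_def)
  have cardI: "card ?I = r - m"
    using card_missed_parts[OF assms] by simp
  have "common_nbrs G K = (\<Union>i\<in>?I. ?X i)"
  proof safe
    fix v assume v: "v \<in> common_nbrs G K"
    then have "v \<in> (\<Union>i\<in>{1..r}. V i)"
      unfolding parts_cover by (simp add: common_nbrs_def)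
    then obtain i where i: "i \<in> {1..r}" "v \<in> V i"
      by blast
    then have "V i \<inter> K = {}"
      using v parts_independent by (fastforce simp: common_nbrs_def)
    then show "v \<in> (\<Union>i\<in>?I. ?X i)"
      using v i by (auto simp: common_nbrs_def)
  next
    fix v i assume "i \<in> {1..r}" "V i \<inter> K = {}" "v \<in> V i" "\<forall>u\<in>K. (u, v) \<in> parcs G"
    then show "v \<in> common_nbrs G K"
      using parts_cover by (auto simp: common_nbrs_def)
  qed
  also have "card \<dots> = (\<Sum>i\<in>?I. card (?X i))"
  proof (rule card_UN_disjoint)
    show "\<forall>i\<in>?I. \<forall>j\<in>?I. i \<noteq> j \<longrightarrow> ?X i \<inter> ?X j = {}"
      using parts_disjoint unfolding disjoint_family_on_def by blast
  qed (use finite_part in auto)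
  finally have eq: "card (common_nbrs G K) = (\<Sum>i\<in>?I. card (?X i))" .
  have "card (?X i) \<le> n" if "i \<in> ?I" for i
    using that card_part[of i] finite_part[of i] by (auto intro!: card_mono)
  then have "(\<Sum>i\<in>?I. card (?X i)) \<le> (r - m) * n"
    using sum_bounded_above[of ?I "\<lambda>i. card (?X i)" n] cardI by simp
  then show "card (common_nbrs G K) \<le> (r - m) * n"
    using eq by simp
  have "real (card ?I) * ((1 - c * m) * n) \<le> (\<Sum>i\<in>?I. real (card (?X i)))"
    using card_common_nbrs_in_part[OF finK sub] cardK by (intro sum_bounded_below) auto
  then show "(1 - c * m) * ((r - m) * n) \<le> card (common_nbrs G K)"
    using eq cardI by (simp add: mult_ac)
qed

text \<open>
  The number \<open>(r - a choose k) * n ^ k\<close> is the exact count in the complete \<open>r\<close>-partite graph. Adding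
  vertices one at a time, the step from \<open>a + j\<close> to \<open>a + j + 1\<close> vertices keeps at least the fraction
  \<open>1 - c (a + j)\<close> of that count, and the product of these factors is bounded below by \<open>1\<close> minus the sum of the
  losses.
\<close>

lemma card_cliques_bounds:
  assumes A: "A \<in> cliques G a B"
  shows "card (cliques G (a + k) A) \<le> (r - a choose k) * n ^ k"
    and "(1 - c * (\<Sum>j<k. real (a + j))) * ((r - a choose k) * n ^ k) \<le> card (cliques G (a + k) A)"
proof (induction k)
  case 0
  { case 1 show ?case using cliques_above_self[OF finite_pverts A] by simp }
  { case 2 show ?case using cliques_above_self[OF finite_pverts A] by simp }
next
  case (Suc k)
  let ?N = "\<lambda>k. (r - a choose k) * n ^ k"
  let ?d = "(r - (a + k)) * n"
  have cardA: "card A = a"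
    using A by (simp add: cliques_def)
  have rec: "Suc k * card (cliques G (a + Suc k) A) =
      (\<Sum>K\<in>cliques G (a + k) A. card (common_nbrs G K))"
    using card_cliques_Suc[OF finite_pverts symmetric, of "a + k" A] cardA by simp
  have "Suc k * (r - a choose Suc k) = (r - a - k) * (r - a choose k)"
    by (metis binomial_absorb_comp binomial_absorption)
  then have "(Suc k * (r - a choose Suc k)) * n ^ Suc k = (r - (a + k)) * (r - a choose k) * n ^ Suc k"
    by simp
  then have Nrec: "Suc k * ?N (Suc k) = ?N k * ?d"
    by (simp only: power_Suc mult_ac)
  { case 1
    have "Suc k * card (cliques G (a + Suc k) A) \<le> card (cliques G (a + k) A) * ?d"
      unfolding rec using sum_bounded_above[OF card_common_nbrs(1)] by simp
    also have "\<dots> \<le> Suc k * ?N (Suc k)"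
      unfolding Nrec using Suc(1) by (intro mult_right_mono) auto
    finally show ?case by (simp only: mult_le_cancel1 zero_less_Suc) }
  { case 2
    let ?x = "c * real (a + k)" and ?y = "c * (\<Sum>j<k. real (a + j))"
    have split: "1 - c * (\<Sum>j<Suc k. real (a + j)) = 1 - ?x - ?y"
      by (simp add: algebra_simps)
    have nonneg: "0 \<le> ?x" "0 \<le> ?y"
      using c_nonneg by (auto intro!: mult_nonneg_nonneg sum_nonneg)
    show ?case
    \<comment> \<open>Multiplying the induction hypothesis by \<open>1 - ?x\<close> requires \<open>?x \<le> 1\<close>; otherwise the claimed
      lower bound is at most \<open>0\<close>.\<close>
    proof (cases "?x \<le> 1")
      case True
      have "(1 - ?x - ?y) * (Suc k * ?N (Suc k)) \<le> ((1 - ?x) * (1 - ?y)) * (?N k * ?d)"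
      proof -
        have "1 - ?x - ?y \<le> (1 - ?x) * (1 - ?y)"
          using mult_nonneg_nonneg[OF nonneg] by (simp add: left_diff_distrib right_diff_distrib)
        then show ?thesis
          unfolding Nrec by (rule mult_right_mono) simp
      qed
      also have "\<dots> = ((1 - ?y) * ?N k) * ((1 - ?x) * ?d)"
        by simp
      also have "\<dots> \<le> card (cliques G (a + k) A) * ((1 - ?x) * ?d)"
        using Suc(2) True by (intro mult_right_mono) auto
      also have "\<dots> \<le> (\<Sum>K\<in>cliques G (a + k) A. real (card (common_nbrs G K)))"
        by (intro sum_bounded_below card_common_nbrs(2))
      also have "\<dots> = Suc k * card (cliques G (a + Suc k) A)"
        using rec by (metis of_nat_mult of_nat_sum)
      finally have "real (Suc k) * ((1 - ?x - ?y) * ?N (Suc k)) \<le>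
          real (Suc k) * card (cliques G (a + Suc k) A)"
        by (simp only: of_nat_mult mult_ac)
      then show ?thesis
        unfolding split by (rule mult_left_le_imp_le) simp
    next
      case False
      then have "(1 - ?x - ?y) * ?N (Suc k) \<le> 0"
        using nonneg by (intro mult_nonpos_nonneg) auto
      then show ?thesis
        unfolding split by (meson of_nat_0_le_iff order_trans)
    qed }
qed

end

section \<open>Shifting weight onto a single edge\<close>

text \<open>
  By symmetry one looks for a weight of \<open>K = Q - T\<close> that depends only on \<open>|e \<inter> T|\<close>, where \<open>T\<close> is a
  pair. Requiring total \<open>1\<close> on \<open>e\<close> and \<open>0\<close> on all other pairs of \<open>Q\<close> gives three linear equations,
  one for each size of the intersection of \<open>e\<close> with the other pair, and the function below is their
  solution, written as a combination of \<open>1\<close>, \<open>|e \<inter> T|\<close> and the indicator of \<open>e = T\<close>: with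
  \<open>d = |e - f|\<close> these three sum to \<open>s (s - 1) / 2\<close>, \<open>d (s - 1)\<close> and the indicator of \<open>d = 2\<close> over all
  \<open>T\<close> that avoid \<open>f\<close>.
\<close>

definition gadget :: "nat \<Rightarrow> 'a set \<Rightarrow> 'a set \<Rightarrow> 'a set \<Rightarrow> real" where
  "gadget s Q e K = 2 / (real s * (real s - 1)) - card (e - K) / (real s - 1) +
     (if e = Q - K then 1 else 0)"

lemma card_subsets_between:
  assumes "finite Q" and "f \<subseteq> Q" and "card f \<le> k"
  shows "card {K. f \<subseteq> K \<and> K \<subseteq> Q \<and> card K = k} = (card Q - card f) choose (k - card f)"
proof -
  have fin: "finite f" using assms finite_subset by blast
  have finK: "finite K" if "K \<subseteq> Q" for K using assms(1) that by (rule rev_finite_subset)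
  have "bij_betw (\<lambda>K. K - f) {K. f \<subseteq> K \<and> K \<subseteq> Q \<and> card K = k}
      {L. L \<subseteq> Q - f \<and> card L = k - card f}"
  proof (rule bij_betw_byWitness[where f' = "\<lambda>L. L \<union> f"])
    show "(\<lambda>L. L \<union> f) ` {L. L \<subseteq> Q - f \<and> card L = k - card f}
        \<subseteq> {K. f \<subseteq> K \<and> K \<subseteq> Q \<and> card K = k}"
    proof safe
      fix L assume L: "L \<subseteq> Q - f" "card L = k - card f"
      then have "finite L" using assms(1) by (meson finite_Diff finite_subset)
      then show "card (L \<union> f) = k"
        using L assms(3) fin by (subst card_Un_disjoint) auto
    qed (use assms in auto)
  qed (use assms fin in \<open>auto simp: card_Diff_subset\<close>)
  then have "card {K. f \<subseteq> K \<and> K \<subseteq> Q \<and> card K = k} = card {L. L \<subseteq> Q - f \<and> card L = k - card f}"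
    by (rule bij_betw_same_card)
  also have "\<dots> = card (Q - f) choose (k - card f)"
    using assms(1) by (intro n_subsets) auto
  finally show ?thesis
    using assms fin by (simp add: card_Diff_subset)
qed

lemma real_choose_two: "real (m choose 2) = real m * (real m - 1) / 2"
  by (induction m) (auto simp: numeral_2_eq_2 field_simps)

text \<open>
  The three terms of the gadget are summed separately and give \<open>1 - |e - f|\<close>, plus \<open>1\<close> if \<open>e\<close> and \<open>f\<close>
  are disjoint. This vanishes both for \<open>|e - f| = 1\<close> and for \<open>|e - f| = 2\<close>.
\<close>

lemma sum_gadget:
  assumes s: "s \<ge> 2" and Q: "finite Q" "card Q = s + 2"
    and e: "e \<subseteq> Q" "card e = 2" and f: "f \<subseteq> Q" "card f = 2"
  shows "(\<Sum>K | f \<subseteq> K \<and> K \<subseteq> Q \<and> card K = s. gadget s Q e K) = (if e = f then 1 else 0)"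
proof -
  let ?S = "{K. f \<subseteq> K \<and> K \<subseteq> Q \<and> card K = s}"
  have finS: "finite ?S"
    using Q(1) by (intro finite_subset[of ?S "Pow Q"]) auto
  have fin: "finite e" "finite f"
    using Q(1) e f finite_subset by blast+
  have cardS: "real (card ?S) = real s * (real s - 1) / 2"
  proof -
    have "card ?S = s choose (s - 2)"
      using card_subsets_between[OF Q(1) f(1), of s] s Q f by simp
    also have "\<dots> = s choose 2"
      using s by (simp add: binomial_symmetric[of 2 s])
    finally show ?thesis
      by (simp add: real_choose_two)
  qed
  have avoiding: "card {K \<in> ?S. x \<notin> K} = (if x \<in> f then 0 else s - 1)" if "x \<in> e" for x
  proof (cases "x \<in> f")
    case False
    have "{K \<in> ?S. x \<notin> K} = {K. f \<subseteq> K \<and> K \<subseteq> Q - {x} \<and> card K = s}"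
      by auto
    also have "card \<dots> = (s - 1) choose (s - 2)"
    proof -
      have "x \<in> Q" "f \<subseteq> Q - {x}"
        using False that e f by auto
      moreover have "s + 1 - 2 = s - 1"
        using s by simp
      ultimately show ?thesis
        using card_subsets_between[of "Q - {x}" f s] s Q f by simp
    qed
    also have "\<dots> = s - 1"
      using binomial_Suc_n[of "s - 2"] s by (metis Suc_diff_le diff_Suc_Suc numeral_2_eq_2 One_nat_def)
    finally show ?thesis
      using False by simp
  next
    case True
    then have "{K \<in> ?S. x \<notin> K} = {}" by blast
    then show ?thesis using True by (simp only: card.empty if_True)
  qed
  have "(\<Sum>K\<in>?S. real (card (e - K))) = (\<Sum>K\<in>?S. \<Sum>x | x \<in> e \<and> x \<notin> K. 1)"
    by (intro sum.cong) (auto simp: set_diff_eq)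
  also have "\<dots> = (\<Sum>x\<in>e. \<Sum>K | K \<in> ?S \<and> x \<notin> K. 1)"
    using finS fin(1) by (intro sum.swap_restrict)
  also have "\<dots> = (\<Sum>x\<in>e. if x \<in> f then 0 else real (s - 1))"
    using avoiding by (intro sum.cong) auto
  also have "\<dots> = (\<Sum>x\<in>e - f. real (s - 1))"
    using fin by (intro sum.mono_neutral_cong_right) auto
  finally have deg: "(\<Sum>K\<in>?S. real (card (e - K))) = card (e - f) * (real s - 1)"
    using s by simp
  have compl: "(\<Sum>K\<in>?S. if e = Q - K then 1 else (0::real)) = (if e \<inter> f = {} then 1 else 0)"
  proof (cases "e \<inter> f = {}")
    case True
    have "card (Q - e) = s" using Q e fin by (simp add: card_Diff_subset)
    then have "Q - e \<in> ?S" using f True by auto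
    moreover have "(e = Q - K) = (K = Q - e)" if "K \<in> ?S" for K
      using that e by auto
    moreover have "(\<Sum>K\<in>?S. if e = Q - K then 1 else (0::real)) =
        (\<Sum>K\<in>?S. if K = Q - e then 1 else 0)"
      using calculation(2) by (intro sum.cong) auto
    ultimately show ?thesis
      using True finS by simp
  next
    case False
    then have "e \<noteq> Q - K" if "K \<in> ?S" for K
      using that by blast
    then show ?thesis
      using False by (simp add: sum.neutral)
  qed
  have "(\<Sum>K\<in>?S. gadget s Q e K) = card ?S * (2 / (real s * (real s - 1))) -
      (\<Sum>K\<in>?S. real (card (e - K))) / (real s - 1) + (\<Sum>K\<in>?S. if e = Q - K then 1 else 0)"
    unfolding gadget_def by (simp add: sum.distrib sum_subtractf sum_divide_distrib)
  also have "\<dots> = 1 - real (card (e - f)) + (if e \<inter> f = {} then 1 else 0)"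
    unfolding cardS deg compl using s by simp
  also have "\<dots> = (if e = f then 1 else 0)"
  proof -
    have split: "card (e - f) + card (e \<inter> f) = 2"
      using card_Diff_subset_Int[of e f] card_mono[of e "e \<inter> f"] fin e by auto
    have "card (e \<inter> f) = 2 \<longleftrightarrow> e = f"
      using e f fin by (metis Int_absorb card_subset_eq inf_le1 inf_le2)
    moreover have "card (e \<inter> f) = 0 \<longleftrightarrow> e \<inter> f = {}"
      using fin by simp
    moreover have "card (e \<inter> f) \<noteq> 1 \<Longrightarrow> card (e \<inter> f) = 0 \<or> card (e \<inter> f) = 2"
      using split by linarith
    ultimately show ?thesis
      using split e by (cases "card (e \<inter> f) = 1") auto
  qed
  finally show ?thesis .
qed

text \<open>
  For \<open>|e - K| = 0, 1, 2\<close> the gadget has the values \<open>2 / (s (s - 1))\<close>, \<open>- (s - 2) / (s (s - 1))\<close> and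
  \<open>(s - 2) / s\<close>, so only the middle one can be negative.
\<close>

lemma gadget_ge:
  assumes s: "s \<ge> 2" and Q: "finite Q" "card Q = s + 2" and e: "e \<subseteq> Q" "card e = 2"
    and K: "K \<subseteq> Q" "card K = s"
  shows "- 1 / s \<le> gadget s Q e K"
proof -
  have fin: "finite e" "finite K"
    using Q(1) e K finite_subset by blast+
  have "card (e - K) \<le> 2"
    using e fin card_mono[of e "e - K"] by auto
  moreover have "e = Q - K" if "card (e - K) = 2"
  proof -
    have "e - K = e" using that e fin by (intro card_subset_eq) auto
    then have "e \<subseteq> Q - K" using e by blast
    moreover have "card (Q - K) = 2" using Q K fin by (simp add: card_Diff_subset)
    ultimately show ?thesis using e Q by (intro card_subset_eq) auto
  qed
  ultimately consider "card (e - K) = 0" | "card (e - K) = 1" | "card (e - K) = 2" "e = Q - K"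
    by linarith
  then show ?thesis
  proof cases
    case 1
    have "0 \<le> gadget s Q e K" unfolding gadget_def 1 using s by simp
    moreover have "- 1 / s \<le> 0" by simp
    ultimately show ?thesis by linarith
  next
    case 2
    have "2 / (real s * (real s - 1)) - 1 / (real s - 1) = - 1 / s + 1 / (real s * (real s - 1))"
      using s by (simp add: divide_simps) (simp add: algebra_simps)
    moreover have "0 \<le> 1 / (real s * (real s - 1))"
      using s by simp
    ultimately show ?thesis unfolding gadget_def 2 by simp
  next
    case 3
    have "2 / (real s * (real s - 1)) - 2 / (real s - 1) + 1 = - 1 / s + (s - 1) / s"
      using s by (simp add: divide_simps of_nat_diff) (simp add: algebra_simps)
    moreover have "0 \<le> real (s - 1) / s"
      by simp
    ultimately show ?thesis unfolding gadget_def 3(1) using 3(2) by simp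
  qed
qed

section \<open>The corrected weighting\<close>

text \<open>
  Every edge \<open>e\<close> falls short of \<open>1\<close> by \<open>1 - card (cliques G s e) / N\<close> under the constant weight
  \<open>1 / N\<close>; an equal share of this deficit goes to each \<open>(s + 2)\<close>-clique through \<open>e\<close>, which passes it on
  to its \<open>s\<close>-subsets by the gadget.
\<close>

definition corrected_weight :: "'a pair_pre_digraph \<Rightarrow> nat \<Rightarrow> real \<Rightarrow> 'a set \<Rightarrow> real" where
  "corrected_weight G s N K = 1 / N + (\<Sum>Q\<in>cliques G (s + 2) K. \<Sum>e | e \<subseteq> Q \<and> card e = 2.
     (1 - card (cliques G s e) / N) / card (cliques G (s + 2) e) * gadget s Q e K)"

lemma clique_pair: "Q \<in> cliques G k A \<Longrightarrow> e \<subseteq> Q \<Longrightarrow> card e = 2 \<Longrightarrow> e \<in> cliques G 2 {}"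
  unfolding cliques_def by blast

text \<open>
  Exchanging the sums, the \<open>s\<close>-cliques between \<open>f\<close> and a fixed \<open>(s + 2)\<close>-clique \<open>Q\<close> are all \<open>s\<close>-sets
  between them, so the gadgets of all \<open>e \<noteq> f\<close> cancel and each \<open>Q\<close> contributes its share of the deficit
  of \<open>f\<close>.
\<close>

lemma sum_corrected_weight:
  assumes fin: "finite (pverts G)" and s: "s \<ge> 2" and f: "f \<in> cliques G 2 {}"
    and extends: "cliques G (s + 2) f \<noteq> {}"
  shows "(\<Sum>K\<in>cliques G s f. corrected_weight G s N K) = 1"
proof -
  let ?y = "\<lambda>e. (1 - card (cliques G s e) / N) / card (cliques G (s + 2) e)"
  let ?E = "\<lambda>Q. {e. e \<subseteq> Q \<and> card e = 2}"
  have above: "cliques G (s + 2) K = {Q \<in> cliques G (s + 2) f. K \<subseteq> Q}"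
    if "K \<in> cliques G s f" for K
    using that by (auto simp: cliques_def)
  have below: "{K \<in> cliques G s f. K \<subseteq> Q} = {K. f \<subseteq> K \<and> K \<subseteq> Q \<and> card K = s}"
    if "Q \<in> cliques G (s + 2) f" for Q
    using that by (auto simp: cliques_def subset_iff)
  have inner: "(\<Sum>K | K \<in> cliques G s f \<and> K \<subseteq> Q. \<Sum>e\<in>?E Q. ?y e * gadget s Q e K) = ?y f"
    if Q: "Q \<in> cliques G (s + 2) f" for Q
  proof -
    have Q': "finite Q" "card Q = s + 2" "f \<subseteq> Q" "card f = 2"
      using Q f finite_clique[OF fin Q] by (auto simp: cliques_def)
    have "(\<Sum>K | K \<in> cliques G s f \<and> K \<subseteq> Q. \<Sum>e\<in>?E Q. ?y e * gadget s Q e K) =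
        (\<Sum>e\<in>?E Q. ?y e * (\<Sum>K | f \<subseteq> K \<and> K \<subseteq> Q \<and> card K = s. gadget s Q e K))"
      unfolding below[OF Q] by (subst sum.swap) (simp add: sum_distrib_left)
    also have "\<dots> = (\<Sum>e\<in>?E Q. if e = f then ?y f else 0)"
      using sum_gadget[OF s Q'(1,2)] Q'(3,4) by (intro sum.cong) auto
    also have "\<dots> = ?y f"
      using Q' by (subst sum.delta) auto
    finally show ?thesis .
  qed
  have "(\<Sum>K\<in>cliques G s f. corrected_weight G s N K) = card (cliques G s f) / N +
      (\<Sum>K\<in>cliques G s f. \<Sum>Q | Q \<in> cliques G (s + 2) f \<and> K \<subseteq> Q.
         \<Sum>e\<in>?E Q. ?y e * gadget s Q e K)"
    unfolding corrected_weight_def sum.distrib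
    by (intro arg_cong2[where f = "(+)"] sum.cong above refl) simp_all
  also have "(\<Sum>K\<in>cliques G s f. \<Sum>Q | Q \<in> cliques G (s + 2) f \<and> K \<subseteq> Q.
         \<Sum>e\<in>?E Q. ?y e * gadget s Q e K) =
      (\<Sum>Q\<in>cliques G (s + 2) f. \<Sum>K | K \<in> cliques G s f \<and> K \<subseteq> Q.
         \<Sum>e\<in>?E Q. ?y e * gadget s Q e K)"
    using finite_cliques[OF fin] by (intro sum.swap_restrict)
  also have "\<dots> = card (cliques G (s + 2) f) * ?y f"
    using inner by simp
  also have "\<dots> = 1 - card (cliques G s f) / N"
    using extends finite_cliques[OF fin] by simp
  finally show ?thesis by simp
qed

text \<open>
  As the deficits are nonnegative, weight is lost only through negative gadget values: at most
  \<open>(\<epsilon> / D) (1 / s)\<close> for each pair in each \<open>(s + 2)\<close>-clique above \<open>K\<close>.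
\<close>

lemma corrected_weight_ge:
  fixes N D \<epsilon> :: real
  assumes fin: "finite (pverts G)" and s: "s \<ge> 2" and K: "K \<in> cliques G s {}"
    and deficit: "\<And>e. e \<in> cliques G 2 {} \<Longrightarrow> card (cliques G s e) \<le> N"
      "\<And>e. e \<in> cliques G 2 {} \<Longrightarrow> (1 - \<epsilon>) * N \<le> card (cliques G s e)"
    and many: "\<And>e. e \<in> cliques G 2 {} \<Longrightarrow> D \<le> card (cliques G (s + 2) e)"
    and pos: "0 < N" "0 < D"
  shows "1 / N - card (cliques G (s + 2) K) * ((s + 2 choose 2) * (\<epsilon> / (D * s)))
    \<le> corrected_weight G s N K"
proof -
  let ?y = "\<lambda>e. (1 - card (cliques G s e) / N) / card (cliques G (s + 2) e)"
  let ?E = "\<lambda>Q. {e. e \<subseteq> Q \<and> card e = 2}"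
  have y: "0 \<le> ?y e" "?y e \<le> \<epsilon> / D" if "e \<in> cliques G 2 {}" for e
  proof -
    have t: "0 \<le> 1 - card (cliques G s e) / N" "1 - card (cliques G s e) / N \<le> \<epsilon>"
      using deficit[OF that] pos by (auto simp: field_simps)
    then show "0 \<le> ?y e" by simp
    show "?y e \<le> \<epsilon> / D"
      using order_trans[OF t] t(2) many[OF that] pos by (intro frac_le)
  qed
  have term_ge: "- (\<epsilon> / (D * s)) \<le> ?y e * gadget s Q e K"
    if Q: "Q \<in> cliques G (s + 2) K" and e: "e \<in> ?E Q" for Q e
  proof -
    have e2: "e \<in> cliques G 2 {}"
      using clique_pair Q e by blast
    have "- (\<epsilon> / (D * s)) = - (\<epsilon> / D * (1 / s))" by simp
    also have "\<dots> \<le> - (?y e * (1 / s))"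
      using mult_right_mono[OF y(2)[OF e2], of "1 / s"] by simp
    also have "\<dots> = ?y e * (- 1 / s)" by simp
    also have "\<dots> \<le> ?y e * gadget s Q e K"
      using y(1)[OF e2] gadget_ge[OF s] Q K e finite_clique[OF fin Q]
      by (intro mult_left_mono) (auto simp: cliques_def)
    finally show ?thesis .
  qed
  have "- ((s + 2 choose 2) * (\<epsilon> / (D * s))) \<le> (\<Sum>e\<in>?E Q. ?y e * gadget s Q e K)"
    if Q: "Q \<in> cliques G (s + 2) K" for Q
  proof -
    have "card (?E Q) = (s + 2) choose 2"
      using n_subsets[OF finite_clique[OF fin Q], of 2] Q by (simp add: cliques_def)
    then show ?thesis
      using sum_bounded_below[of "?E Q", OF term_ge[OF Q]] by simp
  qed
  then have "real (card (cliques G (s + 2) K)) * - ((s + 2 choose 2) * (\<epsilon> / (D * s))) \<le>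
      (\<Sum>Q\<in>cliques G (s + 2) K. \<Sum>e\<in>?E Q. ?y e * gadget s Q e K)"
    by (intro sum_bounded_below) auto
  then show ?thesis
    unfolding corrected_weight_def by simp
qed

section \<open>The weighting is a decomposition\<close>

text \<open>
  The factors multiplying \<open>c\<close> come from \<open>2 + 3 + \<dots> + (s + 1) = s (s + 3) / 2\<close>, the total loss in
  counting \<open>(s + 2)\<close>-cliques through an edge, and \<open>2 + 3 + \<dots> + (s - 1) = (s - 2) (s + 1) / 2\<close>, the
  same for \<open>s\<close>-cliques. The first estimate keeps at least half of the \<open>(s + 2)\<close>-cliques, and the
  second one makes the correction no larger than the constant weight.
\<close>

lemma density_constant_bounds:
  fixes x c :: real
  assumes x: "x \<ge> 3" and c: "c = 1 / ((x - 2) * (x + 1) * (x - 1) ^ 4)"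
  shows "c * (x * (x + 3) / 2) \<le> 1 / 2"
    and "(x - 1) * (x + 1) * (x + 2) * (c * ((x - 2) * (x + 1) / 2)) \<le> 2"
proof -
  \<comment> \<open>In terms of \<open>t = x - 3\<close> the polynomial inequalities hold coefficientwise.\<close>
  define t where "t = x - 3"
  have t: "0 \<le> t" and xt: "x = t + 3"
    using x by (auto simp: t_def)
  have den: "0 < (x - 2) * (x + 1) * (x - 1) ^ 4"
    using x by simp
  have "x * (x + 3) \<le> (x - 2) * (x + 1) * 2 ^ 4"
    using mult_nonneg_nonneg[OF t t] t by (simp add: xt algebra_simps)
  also have "\<dots> \<le> (x - 2) * (x + 1) * (x - 1) ^ 4"
    using x by (intro mult_left_mono power_mono) auto
  finally show "c * (x * (x + 3) / 2) \<le> 1 / 2"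
    unfolding c using den by (simp add: field_simps)
  have "(x + 1) * (x + 2) \<le> 4 * (x - 1) ^ 3"
    using t by (simp add: xt power3_eq_cube algebra_simps)
  then have "(x - 1) * ((x + 1) * (x + 2)) \<le> (x - 1) * (4 * (x - 1) ^ 3)"
    using x by (intro mult_left_mono) auto
  also have "\<dots> = 4 * (x - 1) ^ 4"
    by (simp add: power_numeral_reduce)
  finally have "(x - 1) * ((x + 1) * (x + 2)) / (2 * (x - 1) ^ 4) \<le> 2"
    using x by (simp add: divide_le_eq)
  moreover have "c * ((x - 2) * (x + 1) / 2) = 1 / (2 * (x - 1) ^ 4)"
    unfolding c using x by simp
  ultimately show "(x - 1) * (x + 1) * (x + 2) * (c * ((x - 2) * (x + 1) / 2)) \<le> 2"
    by (simp add: mult.assoc)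
qed

lemma (in dense_partite) corrected_weight_decomposes:
  assumes s: "s \<ge> 3" and r: "r \<ge> s + 2" and n: "n \<ge> 1"
    and c: "c = 1 / ((real s - 2) * (real s + 1) * (real s - 1) ^ 4)"
    and N: "N = (r - 2 choose (s - 2)) * n ^ (s - 2)"
  shows "f \<in> cliques G 2 {} \<Longrightarrow> (\<Sum>K\<in>cliques G s f. corrected_weight G s N K) = 1"
    and "K \<in> cliques G s {} \<Longrightarrow> 0 \<le> corrected_weight G s N K"
proof -
  define \<epsilon> where "\<epsilon> = c * ((real s - 2) * (real s + 1) / 2)"
  define M where "M = real ((r - 2 choose s) * n ^ s)"
  have x: "real s \<ge> 3" using s by simp
  note bounds = density_constant_bounds[OF x c]
  have sum: "(\<Sum>j<k. real (2 + j)) = real k * (real k + 3) / 2" for k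
    by (induction k) (auto simp: field_simps)
  have half: "c * (\<Sum>j<s. real (2 + j)) \<le> 1 / 2"
    unfolding sum by (rule bounds(1))
  have \<epsilon>: "c * (\<Sum>j<s - 2. real (2 + j)) = \<epsilon>"
    unfolding sum using s by (simp add: \<epsilon>_def of_nat_diff)
  have pos: "0 < real N" "0 < M / 2"
    using N r n s by (auto simp: M_def)
  have Nbounds: "real (card (cliques G s e)) \<le> real N" "(1 - \<epsilon>) * real N \<le> card (cliques G s e)"
    if "e \<in> cliques G 2 {}" for e
  proof -
    have "2 + (s - 2) = s" using s by simp
    note b = card_cliques_bounds[OF that, of "s - 2", unfolded this \<epsilon>]
    show "real (card (cliques G s e)) \<le> real N"
      using b(1) unfolding N of_nat_le_iff .
    show "(1 - \<epsilon>) * real N \<le> card (cliques G s e)"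
      using b(2) unfolding N .
  qed
  have Mbound: "M / 2 \<le> card (cliques G (s + 2) e)" if "e \<in> cliques G 2 {}" for e
  proof -
    have "1 / 2 * M \<le> (1 - c * (\<Sum>j<s. real (2 + j))) * M"
      using half pos by (intro mult_right_mono) auto
    also have "\<dots> \<le> card (cliques G (s + 2) e)"
      using card_cliques_bounds(2)[OF that, of s] by (simp add: M_def add.commute)
    finally show ?thesis by simp
  qed
  show "(\<Sum>K\<in>cliques G s f. corrected_weight G s N K) = 1" if f: "f \<in> cliques G 2 {}"
  proof (rule sum_corrected_weight[OF finite_pverts _ f])
    show "cliques G (s + 2) f \<noteq> {}" using Mbound[OF f] pos by auto
  qed (use s in simp)
  show "0 \<le> corrected_weight G s N K" if K: "K \<in> cliques G s {}"
  proof -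
    \<comment> \<open>\<open>B\<close> bounds the number of \<open>(s + 2)\<close>-cliques above \<open>K\<close>. In the complete \<open>r\<close>-partite graph, the
      pairs of an \<open>s\<close>-clique above a given edge and an \<open>(s + 2)\<close>-clique above that number \<open>N * B\<close> and
      \<open>M * (s choose 2)\<close> alike, which makes \<open>r\<close> and \<open>n\<close> cancel from the estimate.\<close>
    define B where "B = real ((r - s choose 2) * n ^ 2)"
    have "N * ((r - s choose 2) * n ^ 2) = (r - 2 choose s) * n ^ s * (s choose 2)"
    proof -
      have "(r - 2 choose s) * (s choose (s - 2)) = (r - 2 choose (s - 2)) * (r - s choose 2)"
      proof -
        have "r - 2 - (s - 2) = r - s" "s - (s - 2) = 2" "s \<le> r - 2"
          using s r by simp_all
        then show ?thesis
          using choose_mult[of "s - 2" s "r - 2"] by simp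
      qed
      moreover have "s choose (s - 2) = s choose 2"
        using s by (simp add: binomial_symmetric[of 2 s])
      moreover have "n ^ s = n ^ (s - 2) * n ^ 2"
        using s power_add[of n "s - 2" 2] by (simp only: le_add_diff_inverse2)
      ultimately show ?thesis unfolding N by (simp add: mult.commute mult.left_commute)
    qed
    then have "real N * B = M * real (s choose 2)"
      unfolding B_def M_def by (metis of_nat_mult)
    then have NB: "B = M * (real s * (real s - 1) / 2) / N"
      using pos by (simp add: real_choose_two field_simps)
    have \<epsilon>0: "0 \<le> \<epsilon>"
      unfolding \<epsilon>_def using c_nonneg s by simp
    have "card (cliques G (s + 2) K) * ((s + 2 choose 2) * (\<epsilon> / (M / 2 * s)))
        \<le> B * ((s + 2 choose 2) * (\<epsilon> / (M / 2 * s)))"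
      using card_cliques_bounds(1)[OF K, of 2] pos \<epsilon>0 unfolding B_def
      by (intro mult_right_mono) (auto simp del: of_nat_mult of_nat_power)
    also have "\<dots> = (real s - 1) * (real s + 1) * (real s + 2) * \<epsilon> / 2 / N"
      unfolding NB using pos s by (simp add: real_choose_two field_simps)
    also have "\<dots> \<le> 1 / N"
      using bounds(2) pos unfolding \<epsilon>_def by (intro divide_right_mono) auto
    finally show ?thesis
      using corrected_weight_ge[OF finite_pverts _ K Nbounds Mbound pos] s by force
  qed
qed

text \<open>A complete graph is determined by its vertex set.\<close>

lemma bij_betw_K_copies:
  assumes "pair_graph G"
  shows "bij_betw pverts (K_copies s G) (cliques G s {})"
proof -
  interpret pair_graph G by fact
  let ?K = "\<lambda>K. \<lparr>pverts = K, parcs = {(u, v). (u, v) \<in> K \<times> K \<and> u \<noteq> v}\<rparr>"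
  show ?thesis
  proof (rule bij_betw_byWitness[where f' = ?K])
    show "\<forall>H\<in>K_copies s G. ?K (pverts H) = H"
      by (auto simp: K_copies_def complete_digraph_pair_def)
    show "pverts ` K_copies s G \<subseteq> cliques G s {}"
      by (auto simp: K_copies_def complete_digraph_pair_def cliques_def subgraph_def)
    show "?K ` cliques G s {} \<subseteq> K_copies s G"
    proof safe
      fix K assume K: "K \<in> cliques G s {}"
      have "wf_digraph (with_proj (?K K))"
        by unfold_locales auto
      then show "?K K \<in> K_copies s G"
        using K finite_clique[OF pair_finite_verts K] wf_digraph
        by (auto simp: K_copies_def complete_digraph_pair_def cliques_def subgraph_def compatible_def)
    qed
  qed auto
qed

lemma fractional_K_decompositionI:
  assumes G: "pair_graph G" and s: "s \<ge> 2"
    and total: "\<And>f. f \<in> cliques G 2 {} \<Longrightarrow> (\<Sum>K\<in>cliques G s f. W K) = (1::real)"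
    and nonneg: "\<And>K. K \<in> cliques G s {} \<Longrightarrow> 0 \<le> W K"
  shows "fractional_K_decomposition s G (\<lambda>H. W (pverts H))"
proof -
  interpret pair_graph G by fact
  note bij = bij_betw_K_copies[OF G, of s]
  have in_clique: "pverts H \<in> cliques G s {}" if "H \<in> K_copies s G" for H
    using bij that by (auto simp: bij_betw_def)
  have "W K \<le> 1" if K: "K \<in> cliques G s {}" for K
  proof -
    have "2 \<le> card K"
      using s K by (simp add: cliques_def)
    then obtain f where f: "f \<subseteq> K" "card f = 2"
      by (rule obtain_subset_with_card_n)
    have f2: "f \<in> cliques G 2 {}"
      using clique_pair[OF K] f by blast
    have "W K \<le> (\<Sum>K\<in>cliques G s f. W K)"
      using K f finite_cliques[OF pair_finite_verts]
      by (intro member_le_sum nonneg) (auto simp: cliques_def)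
    then show ?thesis using total[OF f2] by simp
  qed
  moreover have "(\<Sum>H | H \<in> K_copies s G \<and> e \<in> parcs H. W (pverts H)) = 1" if e: "e \<in> parcs G" for e
  proof -
    obtain u v where uv: "e = (u, v)" by fastforce
    have ends: "u \<in> pverts G" "v \<in> pverts G" "u \<noteq> v" "(v, u) \<in> parcs G"
      using e uv wellformed' pair_no_loops[OF e] pair_sym_arcs
      by (auto simp: symmetric_def sym_def)
    have f2: "{u, v} \<in> cliques G 2 {}"
      using e uv ends by (auto simp: cliques_def)
    have "bij_betw pverts {H \<in> K_copies s G. e \<in> parcs H} {K \<in> cliques G s {}. {u, v} \<subseteq> K}"
    proof (rule bij_betw_subset[OF bij])
      have iff: "e \<in> parcs H \<longleftrightarrow> {u, v} \<subseteq> pverts H" if "H \<in> K_copies s G" for H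
        using that ends(3) uv by (simp add: K_copies_def complete_digraph_pair_def)
      have img: "pverts ` K_copies s G = cliques G s {}"
        using bij by (simp add: bij_betw_def)
      show "pverts ` {H \<in> K_copies s G. e \<in> parcs H} = {K \<in> cliques G s {}. {u, v} \<subseteq> K}"
        unfolding img[symmetric] using iff by blast
    qed blast
    moreover have "{K \<in> cliques G s {}. {u, v} \<subseteq> K} = cliques G s {u, v}"
      by (auto simp: cliques_def)
    ultimately show ?thesis
      using total[OF f2] sum.reindex_bij_betw[of pverts _ _ W] by metis
  qed
  ultimately show ?thesis
    using nonneg in_clique by (auto simp: fractional_K_decomposition_def)
qed

theorem theorem1p2:
  fixes s r n :: nat and c :: real
    and G :: "'a pair_pre_digraph" and V :: "nat \<Rightarrow> 'a set"
  assumes "s \<ge> 3" and "r \<ge> s + 2" and "n \<ge> 1"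
    and "r_partite G r V" and "balanced_parts r V"
    and "card (pverts G) = r * n"
    and "real (partite_min_degree G r V) \<ge> (1 - c) * real n"
    and "c \<le> 1 / ((real s - 2) * (real s + 1) * (real s - 1) ^ 4)"
  shows "\<exists>w. fractional_K_decomposition s G w"
proof -
  \<comment> \<open>The degree condition for \<open>c\<close> implies the one for the largest permitted constant, which is
    positive.\<close>
  let ?c = "1 / ((real s - 2) * (real s + 1) * (real s - 1) ^ 4)"
  interpret pair_graph G
    using assms(4) by (simp add: r_partite_def)
  have cover: "(\<Union>i\<in>{1..r}. V i) = pverts G" and disj: "disjoint_family_on V {1..r}"
    and indep: "\<And>i u v. i \<in> {1..r} \<Longrightarrow> u \<in> V i \<Longrightarrow> v \<in> V i \<Longrightarrow> (u, v) \<notin> parcs G"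
    using assms(4) by (auto simp: r_partite_def)
  have fin: "finite (V i)" if "i \<in> {1..r}" for i
    using that cover pair_finite_verts by (metis UN_upper finite_subset)
  have card_part: "card (V i) = n" if i: "i \<in> {1..r}" for i
  proof -
    have "r * n = (\<Sum>j\<in>{1..r}. card (V j))"
      using disj fin assms(6) unfolding cover[symmetric]
      by (subst card_UN_disjoint[symmetric]) (auto simp: disjoint_family_on_def)
    also have "\<dots> = (\<Sum>j\<in>{1..r}. card (V i))"
      using assms(5) i unfolding balanced_parts_def by (intro sum.cong refl) blast
    finally show ?thesis using assms(1,2) by simp
  qed
  have deg: "(1 - ?c) * n \<le> deg_into G v (V i)" if i: "i \<in> {1..r}" and v: "v \<in> pverts G - V i" for i v
  proof -
    let ?D = "{deg_into G v (V i) |v i. i \<in> {1..r} \<and> v \<in> pverts G - V i}"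
    have "?D \<subseteq> (\<lambda>(v, i). deg_into G v (V i)) ` (pverts G \<times> {1..r})"
      by auto
    then have "finite ?D"
      by (rule finite_subset) (use pair_finite_verts in simp)
    then have "partite_min_degree G r V \<le> deg_into G v (V i)"
      unfolding partite_min_degree_def using i v by (intro Min_le) auto
    moreover have "(1 - ?c) * n \<le> (1 - c) * n"
      using assms(8) by (intro mult_right_mono) auto
    ultimately show ?thesis using assms(7) by linarith
  qed
  interpret dense_partite G r n V ?c
    using pair_finite_verts pair_sym_arcs cover disj indep card_part deg assms(1)
    by unfold_locales auto
  have "fractional_K_decomposition s G
      (\<lambda>H. corrected_weight G s ((r - 2 choose (s - 2)) * n ^ (s - 2)) (pverts H))"
    using corrected_weight_decomposes[OF assms(1-3) refl refl] assms(1)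
    by (intro fractional_K_decompositionI pair_graph_axioms) auto
  then show ?thesis by blast
qed

end
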